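(* Assume that $(\mathbf w_d)_{d\in\{0,\dots,D\}}$ is a sequence of independent random vectors (white noise assumption), and that the Bellman value functions $V^{\mathrm e}_d$, $d\in\{0,\dots,D+1\}$, are nonincreasing: for all $d\in\{0,\dots,D+1\}$ and all $(x,x')\in\mathbb X_d\times\mathbb X_d$, $x\le x'$ implies $V^{\mathrm e}_d(x)\ge V^{\mathrm e}_d(x')$. Define the sequence $(\overline V^{\mathrm R}_d)_{d\in\{0,\dots,D+1\}}$ by $\overline V^{\mathrm R}_{D+1}=K$ and, for all $d\in\{0,\dots,D\}$ (backward) and all $x\in\mathbb X_d$, $$\overline V^{\mathrm R}_d(x)=\inf_{r_{d+1}\in\mathbb X_{d+1}}\Big(L^{\mathrm R}_d(x,r_{d+1})+\overline V^{\mathrm R}_{d+1}(r_{d+1})\Big).$$ Then these functions are upper bounds of the relaxed Bellman value functions: $$V^{\mathrm i}_d\le\overline V^{\mathrm R}_d\qquad\text{for all }d\in\{0,\dots,D+1\}.$$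
   Context: Setting. Let $D\ge 0$ and $M\ge 1$ be integers and $(\Omega,\mathcal F,\mathbb P)$ a probability space, with expectation $\mathbb E$. Bold letters denote random variables and $\sigma(\mathbf z)$ is the $\sigma$-field generated by $\mathbf z$. For $d\in\{0,\dots,D\}$ (slow time) and $m\in\{0,\dots,M\}$ (fast time), $\mathbf w_{d,m}:\Omega\to\mathbb W_{d,m}$ is a random variable (noise) with values in a measurable space, $\mathbf w_d=(\mathbf w_{d,0},\dots,\mathbf w_{d,M})$ takes values in $\mathbb W_d=\prod_{m=0}^M\mathbb W_{d,m}$, and $\mathbf w_{d,0:m}=(\mathbf w_{d,0},\dots,\mathbf w_{d,m})$. Controls are random variables $\mathbf u_d=(\mathbf u_{d,0},\dots,\mathbf u_{d,M})$, with $\mathbf u_{d,m}:\Omega\to\mathbb U_{d,m}$, $\mathbb U_{d,m}$ a measurable space, and $\mathbb U_d=\prod_{m=0}^M\mathbb U_{d,m}$. States are random variables $\mathbf x_d:\Omega\to\mathbb X_d=\mathbb R^{n_d}$, $d\in\{0,\dots,D+1\}$. The instantaneous costs $L_d:\mathbb X_d\times\mathbb U_d\times\mathbb W_d\to[0,+\infty]$, the dynamics $f_d:\mathbb X_d\times\mathbb U_d\times\mathbb W_d\to\mathbb X_{d+1}$ ($d\in\{0,\dots,D\}$) and the final cost $K:\mathbb X_{D+1}\to[0,+\infty]$ are measurable. Inequalities between vectors are componentwise, and equalities and inequalities between random variables hold $\mathbb P$-almost surely. The infimum over an empty set is $+\infty$. Bellman value functions. $V^{\mathrm e}_{D+1}=V^{\mathrm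 i}_{D+1}=K$ and, for $d=D,\dots,0$ and $x\in\mathbb X_d$, $$V^{\mathrm e}_d(x)=\inf_{\mathbf x_{d+1},\mathbf u_d}\mathbb E\big[L_d(x,\mathbf u_d,\mathbf w_d)+V^{\mathrm e}_{d+1}(\mathbf x_{d+1})\big]$$ subject to $\mathbf x_{d+1}=f_d(x,\mathbf u_d,\mathbf w_d)$ and $\sigma(\mathbf u_{d,m})\subset\sigma(\mathbf w_{d,0:m})$ for all $m\in\{0,\dots,M\}$; $$V^{\mathrm i}_d(x)=\inf_{\mathbf x_{d+1},\mathbf u_d}\mathbb E\big[L_d(x,\mathbf u_d,\mathbf w_d)+V^{\mathrm i}_{d+1}(\mathbf x_{d+1})\big]$$ subject to $f_d(x,\mathbf u_d,\mathbf w_d)\ge\mathbf x_{d+1}$, $\sigma(\mathbf u_{d,m})\subset\sigma(\mathbf w_{d,0:m})$ for all $m\in\{0,\dots,M\}$, and $\sigma(\mathbf x_{d+1})\subset\sigma(\mathbf w_{d,0:M})$. Resource intraday functions. For $d\in\{0,\dots,D\}$, $x\in\mathbb X_d$ and (deterministic) $r\in\mathbb X_{d+1}$, $$L^{\mathrm R}_d(x,r)=\inf_{\mathbf u_d}\ \mathbb E\big[L_d(x,\mathbf u_d,\mathbf w_d)\big]\in[0,+\infty]$$ subject to $f_d(x,\mathbf u_d,\mathbf w_d)\ge r$ and $\sigma(\mathbf u_{d,m})\subset\sigma(\mathbf w_{d,0:m})$ for all $m\in\{0,\dots,M\}$. *)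

theory Defs
  imports "HOL-Probability.Probability"
begin

text \<open>
  Data of a two-time-scale stochastic optimal control problem.  The spaces indexed by slow time
  \<open>d\<close> and fast time \<open>m\<close> are different measurable spaces over common carrier types.  Vectors over
  fast time \<open>0, \<dots>, M\<close> are elements of the finite product \<open>PiM {..M}\<close>, and the state space
  of dimension \<open>n d\<close> is the product of \<open>n d\<close> copies of the Borel real line, so that states are
  extensional functions on \<open>{..<n d}\<close>.
\<close>

record ('a, 'w, 'u) two_scale =
  prob_sp :: "'a measure"
  slow_hor :: nat
  fast_hor :: nat
  noise_sp :: "nat \<Rightarrow> nat \<Rightarrow> 'w measure"
  control_sp :: "nat \<Rightarrow> nat \<Rightarrow> 'u measure"
  state_dim :: "nat \<Rightarrow> nat"
  noise :: "nat \<Rightarrow> nat \<Rightarrow> 'a \<Rightarrow> 'w"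
  inst_cost :: "nat \<Rightarrow> (nat \<Rightarrow> real) \<times> (nat \<Rightarrow> 'u) \<times> (nat \<Rightarrow> 'w) \<Rightarrow> ennreal"
  dyn :: "nat \<Rightarrow> (nat \<Rightarrow> real) \<times> (nat \<Rightarrow> 'u) \<times> (nat \<Rightarrow> 'w) \<Rightarrow> (nat \<Rightarrow> real)"
  final_cost :: "(nat \<Rightarrow> real) \<Rightarrow> ennreal"

definition state_sp :: "('a, 'w, 'u) two_scale \<Rightarrow> nat \<Rightarrow> (nat \<Rightarrow> real) measure" where
  "state_sp S d = PiM {..<state_dim S d} (\<lambda>_. borel)"

definition noise_vec_sp :: "('a, 'w, 'u) two_scale \<Rightarrow> nat \<Rightarrow> nat \<Rightarrow> (nat \<Rightarrow> 'w) measure" where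
  "noise_vec_sp S d m = PiM {..m} (noise_sp S d)"

definition control_vec_sp :: "('a, 'w, 'u) two_scale \<Rightarrow> nat \<Rightarrow> (nat \<Rightarrow> 'u) measure" where
  "control_vec_sp S d = PiM {..fast_hor S} (control_sp S d)"

definition noise_vec :: "('a, 'w, 'u) two_scale \<Rightarrow> nat \<Rightarrow> nat \<Rightarrow> 'a \<Rightarrow> (nat \<Rightarrow> 'w)" where
  "noise_vec S d m \<omega> = (\<lambda>k\<in>{..m}. noise S d k \<omega>)"

definition control_vec ::
    "('a, 'w, 'u) two_scale \<Rightarrow> (nat \<Rightarrow> 'a \<Rightarrow> 'u) \<Rightarrow> 'a \<Rightarrow> (nat \<Rightarrow> 'u)" where
  "control_vec S u \<omega> = (\<lambda>k\<in>{..fast_hor S}. u k \<omega>)"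

locale two_scale_problem =
  fixes S :: "('a, 'w, 'u) two_scale"
  assumes prob_space_prob_sp: "prob_space (prob_sp S)"
    and fast_hor_ge_1: "fast_hor S \<ge> 1"
    and noise_measurable: "\<And>d m. d \<le> slow_hor S \<Longrightarrow> m \<le> fast_hor S \<Longrightarrow>
          noise S d m \<in> prob_sp S \<rightarrow>\<^sub>M noise_sp S d m"
    and inst_cost_measurable: "\<And>d. d \<le> slow_hor S \<Longrightarrow>
          inst_cost S d \<in> borel_measurable
            (state_sp S d \<Otimes>\<^sub>M control_vec_sp S d \<Otimes>\<^sub>M noise_vec_sp S d (fast_hor S))"
    and dyn_measurable: "\<And>d. d \<le> slow_hor S \<Longrightarrow>
          dyn S d \<in> (state_sp S d \<Otimes>\<^sub>M control_vec_sp S d \<Otimes>\<^sub>M noise_vec_sp S d (fast_hor S))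
            \<rightarrow>\<^sub>M state_sp S (Suc d)"
    and final_cost_measurable:
          "final_cost S \<in> borel_measurable (state_sp S (Suc (slow_hor S)))"

definition state_le :: "('a, 'w, 'u) two_scale \<Rightarrow> nat \<Rightarrow> (nat \<Rightarrow> real) \<Rightarrow> (nat \<Rightarrow> real) \<Rightarrow> bool" where
  "state_le S d x y \<longleftrightarrow> (\<forall>i<state_dim S d. x i \<le> y i)"

definition sigma_gen :: "'a measure \<Rightarrow> 'b measure \<Rightarrow> ('a \<Rightarrow> 'b) \<Rightarrow> 'a set set" where
  "sigma_gen P N z = sets (vimage_algebra (space P) z N)"

definition noise_sigma :: "('a, 'w, 'u) two_scale \<Rightarrow> nat \<Rightarrow> nat \<Rightarrow> 'a set set" where
  "noise_sigma S d m = sigma_gen (prob_sp S) (noise_vec_sp S d m) (noise_vec S d m)"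

definition nonanticipative :: "('a, 'w, 'u) two_scale \<Rightarrow> nat \<Rightarrow> (nat \<Rightarrow> 'a \<Rightarrow> 'u) \<Rightarrow> bool" where
  "nonanticipative S d u \<longleftrightarrow>
     (\<forall>m\<le>fast_hor S. u m \<in> prob_sp S \<rightarrow>\<^sub>M control_sp S d m \<and>
        sigma_gen (prob_sp S) (control_sp S d m) (u m) \<subseteq> noise_sigma S d m)"

definition rand_cost ::
    "('a, 'w, 'u) two_scale \<Rightarrow> nat \<Rightarrow> (nat \<Rightarrow> real) \<Rightarrow> (nat \<Rightarrow> 'a \<Rightarrow> 'u) \<Rightarrow> 'a \<Rightarrow> ennreal" where
  "rand_cost S d x u \<omega> = inst_cost S d (x, control_vec S u \<omega>, noise_vec S d (fast_hor S) \<omega>)"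

definition rand_dyn ::
    "('a, 'w, 'u) two_scale \<Rightarrow> nat \<Rightarrow> (nat \<Rightarrow> real) \<Rightarrow> (nat \<Rightarrow> 'a \<Rightarrow> 'u) \<Rightarrow> 'a \<Rightarrow> (nat \<Rightarrow> real)" where
  "rand_dyn S d x u \<omega> = dyn S d (x, control_vec S u \<omega>, noise_vec S d (fast_hor S) \<omega>)"

definition feasible_e :: "('a, 'w, 'u) two_scale \<Rightarrow> nat \<Rightarrow> (nat \<Rightarrow> real) \<Rightarrow>
    (('a \<Rightarrow> (nat \<Rightarrow> real)) \<times> (nat \<Rightarrow> 'a \<Rightarrow> 'u)) set" where
  "feasible_e S d x = {(x', u).
     x' \<in> prob_sp S \<rightarrow>\<^sub>M state_sp S (Suc d) \<and> nonanticipative S d u \<and>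
     (AE \<omega> in prob_sp S. x' \<omega> = rand_dyn S d x u \<omega>)}"

definition feasible_i :: "('a, 'w, 'u) two_scale \<Rightarrow> nat \<Rightarrow> (nat \<Rightarrow> real) \<Rightarrow>
    (('a \<Rightarrow> (nat \<Rightarrow> real)) \<times> (nat \<Rightarrow> 'a \<Rightarrow> 'u)) set" where
  "feasible_i S d x = {(x', u).
     x' \<in> prob_sp S \<rightarrow>\<^sub>M state_sp S (Suc d) \<and> nonanticipative S d u \<and>
     (AE \<omega> in prob_sp S. state_le S (Suc d) (x' \<omega>) (rand_dyn S d x u \<omega>)) \<and>
     sigma_gen (prob_sp S) (state_sp S (Suc d)) x' \<subseteq> noise_sigma S d (fast_hor S)}"

text \<open>
  The value functions are not assumed measurable.  The expectation of a \<open>[0, \<infinity>]\<close>-valued function is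
  the nonnegative integral of the library, which is defined for every function and is the lower
  integral when the integrand is not measurable.
\<close>

function value_e :: "('a, 'w, 'u) two_scale \<Rightarrow> nat \<Rightarrow> (nat \<Rightarrow> real) \<Rightarrow> ennreal" where
  "value_e S d x =
     (if slow_hor S < d then final_cost S x
      else INF (x', u)\<in>feasible_e S d x.
             \<integral>\<^sup>+ \<omega>. rand_cost S d x u \<omega> + value_e S (Suc d) (x' \<omega>) \<partial>prob_sp S)"
  by pat_completeness auto
termination
  by (relation "Wellfounded.measure (\<lambda>(S, d, x). Suc (slow_hor S) - d)") auto

function value_i :: "('a, 'w, 'u) two_scale \<Rightarrow> nat \<Rightarrow> (nat \<Rightarrow> real) \<Rightarrow> ennreal" where
  "value_i S d x =
     (if slow_hor S < d then final_cost S x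
      else INF (x', u)\<in>feasible_i S d x.
             \<integral>\<^sup>+ \<omega>. rand_cost S d x u \<omega> + value_i S (Suc d) (x' \<omega>) \<partial>prob_sp S)"
  by pat_completeness auto
termination
  by (relation "Wellfounded.measure (\<lambda>(S, d, x). Suc (slow_hor S) - d)") auto

definition resource_intraday ::
    "('a, 'w, 'u) two_scale \<Rightarrow> nat \<Rightarrow> (nat \<Rightarrow> real) \<Rightarrow> (nat \<Rightarrow> real) \<Rightarrow> ennreal" where
  "resource_intraday S d x r =
     (INF u\<in>{u. nonanticipative S d u \<and>
                (AE \<omega> in prob_sp S. state_le S (Suc d) r (rand_dyn S d x u \<omega>))}.
        \<integral>\<^sup>+ \<omega>. rand_cost S d x u \<omega> \<partial>prob_sp S)"

function value_R :: "('a, 'w, 'u) two_scale \<Rightarrow> nat \<Rightarrow> (nat \<Rightarrow> real) \<Rightarrow> ennreal" where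
  "value_R S d x =
     (if slow_hor S < d then final_cost S x
      else INF r\<in>space (state_sp S (Suc d)). resource_intraday S d x r + value_R S (Suc d) r)"
  by pat_completeness auto
termination
  by (relation "Wellfounded.measure (\<lambda>(S, d, x). Suc (slow_hor S) - d)") auto

text \<open>The unconditional recursion equations would make the simplifier loop.\<close>

declare value_e.simps [simp del] value_i.simps [simp del] value_R.simps [simp del]

definition white_noise :: "('a, 'w, 'u) two_scale \<Rightarrow> bool" where
  "white_noise S \<longleftrightarrow>
     prob_space.indep_vars (prob_sp S) (\<lambda>d. noise_vec_sp S d (fast_hor S))
       (\<lambda>d. noise_vec S d (fast_hor S)) {..slow_hor S}"

end

theory Submission
  imports Defs
begin

text \<open>A deterministic target \<open>r\<close> is a special case of the random next state in
  the relaxed problem. A constant generates the trivial \<sigma>-field, so if \<open>u\<close> is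
  admissible for \<open>resource_intraday S d x r\<close>, the pair of the constant \<open>r\<close>
  and \<open>u\<close> is admissible for \<open>value_i S d x\<close>, with cost E[L] +
  \<open>value_i S (Suc d) r\<close>. The infimum over \<open>u\<close> gives the one-step bound
  \<open>value_i_le_resource\<close>; backward induction in \<open>d\<close> and the infimum over
  \<open>r\<close> then give \<open>value_i_le_value_R\<close>.\<close>

context two_scale_problem
begin

lemma noise_vec_measurable:
  assumes "d \<le> slow_hor S" "m \<le> fast_hor S"
  shows "noise_vec S d m \<in> prob_sp S \<rightarrow>\<^sub>M noise_vec_sp S d m"
  unfolding noise_vec_def noise_vec_sp_def
  by (rule measurable_restrict) (use assms in \<open>auto intro: noise_measurable\<close>)

lemma control_vec_measurable:
  assumes "nonanticipative S d u"
  shows "control_vec S u \<in> prob_sp S \<rightarrow>\<^sub>M control_vec_sp S d"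
  unfolding control_vec_def control_vec_sp_def
  by (rule measurable_restrict) (use assms in \<open>auto simp: nonanticipative_def\<close>)

text \<open>Needed to split the integral of cost plus constant: additivity of
  \<open>nn_integral\<close> requires measurable integrands.\<close>

lemma rand_cost_measurable:
  assumes "d \<le> slow_hor S" "x \<in> space (state_sp S d)" "nonanticipative S d u"
  shows "rand_cost S d x u \<in> borel_measurable (prob_sp S)"
proof -
  note [measurable] = inst_cost_measurable[OF assms(1)] control_vec_measurable[OF assms(3)]
    noise_vec_measurable[OF assms(1) order_refl]
  have [measurable]: "(\<lambda>_. x) \<in> prob_sp S \<rightarrow>\<^sub>M state_sp S d"
    using assms(2) by simp
  show ?thesis
    unfolding rand_cost_def by measurable
qed

text \<open>The preimage of any set under a constant map is empty or the whole space, and every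
  \<sigma>-field on that space contains both.\<close>

lemma sigma_gen_const_subset: "sigma_gen P N (\<lambda>_. c) \<subseteq> sigma_gen P N' z"
proof -
  let ?V = "vimage_algebra (space P) z N'"
  have "(\<lambda>_. c) -` B \<inter> space P \<in> sets ?V" for B
    using sets.top[of ?V] by (cases "c \<in> B") auto
  then have "sigma_sets (space P) {(\<lambda>_. c) -` B \<inter> space P | B. B \<in> sets N} \<subseteq> sets ?V"
    using sets.top[of ?V] by (intro sets.sigma_sets_subset') auto
  then show ?thesis
    by (simp only: sigma_gen_def sets_vimage_algebra)
qed

lemma value_i_le_resource:
  assumes d: "d \<le> slow_hor S" and x: "x \<in> space (state_sp S d)"
    and r: "r \<in> space (state_sp S (Suc d))"
  shows "value_i S d x \<le> resource_intraday S d x r + value_i S (Suc d) r"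
proof -
  interpret prob_space "prob_sp S" by (rule prob_space_prob_sp)
  let ?c = "value_i S (Suc d) r"
  have le: "value_i S d x \<le> (\<integral>\<^sup>+ \<omega>. rand_cost S d x u \<omega> \<partial>prob_sp S) + ?c"
    if u: "nonanticipative S d u"
      "AE \<omega> in prob_sp S. state_le S (Suc d) r (rand_dyn S d x u \<omega>)" for u
  proof -
    have "((\<lambda>_. r), u) \<in> feasible_i S d x"
      using u r by (auto simp: feasible_i_def noise_sigma_def intro: subsetD[OF sigma_gen_const_subset])
    then have "value_i S d x \<le> (\<integral>\<^sup>+ \<omega>. rand_cost S d x u \<omega> + ?c \<partial>prob_sp S)"
      using d by (subst value_i.simps) (auto intro!: INF_lower2)
    \<comment> \<open>As \<open>r\<close> is deterministic, the continuation value is a constant,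
      which a probability measure integrates to itself; measurability of \<open>value_i\<close> is
      not at issue.\<close>
    also have "\<dots> = (\<integral>\<^sup>+ \<omega>. rand_cost S d x u \<omega> \<partial>prob_sp S) + ?c"
      using rand_cost_measurable[OF d x u(1)]
      by (subst nn_integral_add) (auto simp: emeasure_space_1)
    finally show ?thesis .
  qed
  show ?thesis
  \<comment> \<open>To pass to the infimum over \<open>u\<close>, the constant is moved to the left
    by subtraction. This is an equivalence for finite \<open>?c\<close>, but
    \<open>top - top = top\<close> in \<open>ennreal\<close>; for infinite \<open>?c\<close> the
    bound is trivial.\<close>
  proof (cases "?c = top")
    case False
    then have "value_i S d x - ?c \<le> resource_intraday S d x r"
      unfolding resource_intraday_def
      by (intro INF_greatest) (use le in \<open>auto simp: ennreal_minus_le_iff add.commute\<close>)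
    then show ?thesis
      by (auto simp: ennreal_minus_le_iff add.commute)
  qed simp
qed

text \<open>Backward induction from the final date, where both sides are the final cost. The state
  is generalised because the hypothesis at \<open>Suc d\<close> is applied to the target
  \<open>r\<close>.\<close>

lemma value_i_le_value_R:
  assumes "d \<le> Suc (slow_hor S)" "x \<in> space (state_sp S d)"
  shows "value_i S d x \<le> value_R S d x"
  using assms
proof (induction arbitrary: x rule: inc_induct)
  case base
  then show ?case by (simp add: value_i.simps value_R.simps)
next
  case (step d)
  then have d: "d \<le> slow_hor S" by simp
  have "value_i S d x \<le> resource_intraday S d x r + value_R S (Suc d) r"
    if r: "r \<in> space (state_sp S (Suc d))" for r
    using value_i_le_resource[OF d step.prems r] add_left_mono[OF step.IH[OF r]]
    by (rule order_trans)
  then show ?case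
    using d by (subst value_R.simps) (auto intro: INF_greatest)
qed

end

theorem proposition10:
  fixes S :: "('a, 'w, 'u) two_scale"
  assumes "two_scale_problem S"
    and "white_noise S"
    and "\<And>d x x'. d \<le> Suc (slow_hor S) \<Longrightarrow>
           x \<in> space (state_sp S d) \<Longrightarrow> x' \<in> space (state_sp S d) \<Longrightarrow>
           state_le S d x x' \<Longrightarrow> value_e S d x' \<le> value_e S d x"
  shows "\<forall>d\<le>Suc (slow_hor S). \<forall>x\<in>space (state_sp S d). value_i S d x \<le> value_R S d x"
  using two_scale_problem.value_i_le_value_R[OF assms(1)] by blast

end
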